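(* For every $\epsilon\in(0,1)$, the interactive capacity $C_I(\epsilon)$ of the binary erasure channel $\mathrm{BEC}(\epsilon)$ with erasure probability $\epsilon$ satisfies $$C_I(\epsilon)\ \geq\ \frac{(1-\epsilon)^2}{2\left(2-(1-\epsilon)^2\right)}.$$
   Context: The channel $\mathrm{BEC}(\epsilon)$ takes an input bit and outputs that bit with probability $1-\epsilon$ and an erasure symbol $\perp$ with probability $\epsilon$, independently over uses. Protocols. A (noiseless, alternating) protocol $\pi$ of communication complexity $CC(\pi)=n_0$ between Alice (input $x_A$) and Bob (input $x_B$) consists of $n_0$ one-bit transmissions; Alice transmits in odd rounds and Bob in even rounds. In round $r$ the sender $P\in\{A,B\}$ sends $m_r=\pi(x_P,m^{r-1})\in\{0,1\}$, where $m^{r-1}=(m_1,\dots,m_{r-1})$ is the string of bits exchanged so far. The output (transcript) of $\pi$ is $m^{n_0}$. Simulations. A simulation $\tilde\pi$ of $\pi$ over $\mathrm{BEC}(\epsilon)$ is an interactive protocol in which every transmitted bit passes through an independent use of $\mathrm{BEC}(\epsilon)$. The order of speaking is fixed beforehand (non-adaptive) but need not be alternating. Each transmitted bit depends on the sender's input, on everything the sender has sent and received so far, and on $\pi$. $CC(\tilde\pi)$ is the total number of bits transmitted. At the end Alice and Bob output estimates $\tilde m_A^{n_0}$, $\tilde m_B^{n_0}$ of $m^{n_0}$, each based on $\pi$, the party's own input and the party's own sent and received symbols. An error occurs if $\tilde m_A^{n_0}\neq m^{n_0}$ or $\tilde m_B^{n_0}\neq m^{n_0}$. $P_e(\tilde\pi)$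 is the probability of error over the channel erasures (maximum over the inputs $x_A,x_B$). Capacity. $R\ge 0$ is an achievable interactive coding rate for $\mathrm{BEC}(\epsilon)$ if for any sequence of protocols $\pi_{n_0}$, $n_0\ge1$, with $CC(\pi_{n_0})=n_0$, there is a sequence of simulations $\tilde\pi_{n_0}$ of $\pi_{n_0}$ over $\mathrm{BEC}(\epsilon)$ with $\frac{n_0}{CC(\tilde\pi_{n_0})}\to R$ and $P_e(\tilde\pi_{n_0})\to0$ as $n_0\to\infty$. The interactive capacity $C_I(\epsilon)$ is the supremum of all achievable interactive coding rates for $\mathrm{BEC}(\epsilon)$. *)

theory Defs
  imports "HOL-Probability.Probability"
begin

datatype party = Alice | Bob

text \<open>
  Inputs range over arbitrary types \<open>'a\<close> (Alice) and \<open>'b\<close> (Bob).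
  The argument of type \<^typ>\<open>bool list\<close> is the string of bits exchanged so far, oldest bit first.
\<close>

record ('a, 'b) protocol =
  rounds :: nat
  msgA :: "'a \<Rightarrow> bool list \<Rightarrow> bool"
  msgB :: "'b \<Rightarrow> bool list \<Rightarrow> bool"

primrec exchanged :: "('a, 'b) protocol \<Rightarrow> 'a \<Rightarrow> 'b \<Rightarrow> nat \<Rightarrow> bool list" where
  "exchanged \<pi> xA xB 0 = []"
| "exchanged \<pi> xA xB (Suc r) =
     (let m = exchanged \<pi> xA xB r
      in m @ [if odd (Suc r) then msgA \<pi> xA m else msgB \<pi> xB m])"

definition transcript :: "('a, 'b) protocol \<Rightarrow> 'a \<Rightarrow> 'b \<Rightarrow> bool list" where
  "transcript \<pi> xA xB = exchanged \<pi> xA xB (rounds \<pi>)"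

text \<open>The erasure symbol is \<^term>\<open>None\<close>.\<close>

definition bec :: "real \<Rightarrow> bool \<Rightarrow> bool option pmf" where
  "bec \<epsilon> b = map_pmf (\<lambda>erased. if erased then None else Some b) (bernoulli_pmf \<epsilon>)"

text \<open>
  A party's view of a simulation lists, oldest first, the symbols it has sent and received.
  There is no feedback: the sender of a bit does not see whether that bit was erased.
\<close>

datatype symbol = Sent bool | Received "bool option"

text \<open>
  The order of speaking is a list fixed in advance, one entry per channel use.
  Simulations are chosen per protocol, so dependence on the simulated protocol is implicit.
\<close>

record ('a, 'b) simulation =
  speakers :: "party list"
  encA :: "'a \<Rightarrow> symbol list \<Rightarrow> bool"
  encB :: "'b \<Rightarrow> symbol list \<Rightarrow> bool"
  decA :: "'a \<Rightarrow> symbol list \<Rightarrow> bool list"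
  decB :: "'b \<Rightarrow> symbol list \<Rightarrow> bool list"

definition sim_cc :: "('a, 'b) simulation \<Rightarrow> nat" where
  "sim_cc \<tau> = length (speakers \<tau>)"

text \<open>
  Joint distribution of the final views of Alice and Bob when the speakers in the list are
  still to transmit and the current views are \<open>vA\<close> and \<open>vB\<close>.
\<close>

primrec run_from ::
  "real \<Rightarrow> ('a, 'b) simulation \<Rightarrow> 'a \<Rightarrow> 'b \<Rightarrow> party list \<Rightarrow> symbol list \<Rightarrow> symbol list
    \<Rightarrow> (symbol list \<times> symbol list) pmf" where
  "run_from \<epsilon> \<tau> xA xB [] vA vB = return_pmf (vA, vB)"
| "run_from \<epsilon> \<tau> xA xB (P # Ps) vA vB =
     (case P of
        Alice \<Rightarrow>
          (let b = encA \<tau> xA vA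
           in bind_pmf (bec \<epsilon> b)
                (\<lambda>y. run_from \<epsilon> \<tau> xA xB Ps (vA @ [Sent b]) (vB @ [Received y])))
      | Bob \<Rightarrow>
          (let b = encB \<tau> xB vB
           in bind_pmf (bec \<epsilon> b)
                (\<lambda>y. run_from \<epsilon> \<tau> xA xB Ps (vA @ [Received y]) (vB @ [Sent b]))))"

definition run_sim ::
  "real \<Rightarrow> ('a, 'b) simulation \<Rightarrow> 'a \<Rightarrow> 'b \<Rightarrow> (symbol list \<times> symbol list) pmf" where
  "run_sim \<epsilon> \<tau> xA xB = run_from \<epsilon> \<tau> xA xB (speakers \<tau>) [] []"

definition error_prob_at ::
  "real \<Rightarrow> ('a, 'b) protocol \<Rightarrow> ('a, 'b) simulation \<Rightarrow> 'a \<Rightarrow> 'b \<Rightarrow> real" where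
  "error_prob_at \<epsilon> \<pi> \<tau> xA xB =
     measure_pmf.prob (run_sim \<epsilon> \<tau> xA xB)
       {(vA, vB). decA \<tau> xA vA \<noteq> transcript \<pi> xA xB \<or> decB \<tau> xB vB \<noteq> transcript \<pi> xA xB}"

text \<open>
  For a fixed simulation the probabilities take finitely many values, so the supremum is a maximum.
\<close>

definition error_prob ::
  "real \<Rightarrow> ('a, 'b) protocol \<Rightarrow> ('a, 'b) simulation \<Rightarrow> real" where
  "error_prob \<epsilon> \<pi> \<tau> = (SUP (xA, xB)\<in>UNIV. error_prob_at \<epsilon> \<pi> \<tau> xA xB)"

text \<open>
  The type arguments fix the types of the inputs. The division convention \<open>x / 0 = 0\<close> for a
  simulation without transmissions can only affect the rate \<open>0\<close>.
\<close>

definition achievable_rate :: "'a itself \<Rightarrow> 'b itself \<Rightarrow> real \<Rightarrow> real \<Rightarrow> bool" where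
  "achievable_rate (_ :: 'a itself) (_ :: 'b itself) \<epsilon> R \<longleftrightarrow>
     R \<ge> 0 \<and>
     (\<forall>\<pi> :: nat \<Rightarrow> ('a, 'b) protocol. (\<forall>n\<ge>1. rounds (\<pi> n) = n) \<longrightarrow>
       (\<exists>\<tau> :: nat \<Rightarrow> ('a, 'b) simulation.
          (\<lambda>n. real n / real (sim_cc (\<tau> n))) \<longlonglongrightarrow> R \<and>
          (\<lambda>n. error_prob \<epsilon> (\<pi> n) (\<tau> n)) \<longlonglongrightarrow> 0))"

text \<open>
  The supremum is taken in the extended reals because the achievable rates are unbounded
  for degenerate input types, such as \<^typ>\<open>unit\<close>.
\<close>

definition interactive_capacity :: "'a itself \<Rightarrow> 'b itself \<Rightarrow> real \<Rightarrow> ereal" where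
  "interactive_capacity TA TB \<epsilon> = Sup (ereal ` {R. achievable_rate TA TB \<epsilon> R})"

end

theory Submission imports Defs "HOL-Real_Asymp.Real_Asymp"
begin

text \<open>
  The parties take turns in slots of two channel uses. A party always knows the transcript up to
  and including one of its own bits (Bob may know nothing yet), and in its slot it sends the last
  bit it knows followed by one bit describing the length of what it knows. The known lengths always
  differ by exactly one, so that one bit lets the receiver decide whether the message is new. A slot
  gets through with probability \<open>p = (1 - \<epsilon>)\<^sup>2\<close>, and it makes progress if moreover the sender is
  ahead. After progress the next sender is ahead; after a failure the next slot is wasted. Hence one
  transcript bit costs \<open>1 + 2 (1 - p) / p = (2 - p) / p\<close> slots on average. The deviation from the
  average is controlled by Chebyshev's inequality for a martingale with bounded increments.
\<close>

section \<open>Simulation by slots\<close>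

text \<open>
  Alice knows an odd number of bits and Bob an even number, so the parity of half the sender's
  length determines it modulo 4. The receiver accepts only if the sender is one bit ahead.
\<close>

definition slot_update :: "(bool list \<Rightarrow> bool) \<Rightarrow> bool list \<Rightarrow> symbol \<Rightarrow> symbol \<Rightarrow> bool list" where
  "slot_update f m s s' =
     (case (s, s') of
        (Received (Some b), Received (Some c)) \<Rightarrow>
          if c = even (Suc (length m) div 2) then m @ [b, f (m @ [b])] else m
      | _ \<Rightarrow> m)"

text \<open>A trailing half slot is ignored, so both bits of a slot are computed from the same
  knowledge.\<close>

fun known :: "(bool list \<Rightarrow> bool) \<Rightarrow> bool list \<Rightarrow> symbol list \<Rightarrow> bool list" where
  "known f m (s # s' # v) = known f (slot_update f m s s') v"
| "known f m v = m"

lemma known_snoc: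
  "even (length v) \<Longrightarrow> known f m (v @ [s]) = known f m v"
  by (induction f m v rule: known.induct) auto

lemma known_append_slot:
  "even (length v) \<Longrightarrow> known f m (v @ [s, s']) = slot_update f (known f m v) s s'"
  by (induction f m v rule: known.induct) auto

text \<open>
  Before Bob has learnt anything, \<^term>\<open>last []\<close> is unspecified, but Alice then rejects his slot.
\<close>

definition slot_bit :: "bool list \<Rightarrow> symbol list \<Rightarrow> bool" where
  "slot_bit m v = (if even (length v) then last m else even (length m div 2))"

abbreviation knownA :: "('a, 'b) protocol \<Rightarrow> 'a \<Rightarrow> symbol list \<Rightarrow> bool list" where
  "knownA \<pi> x \<equiv> known (msgA \<pi> x) [msgA \<pi> x []]"

abbreviation knownB :: "('a, 'b) protocol \<Rightarrow> 'b \<Rightarrow> symbol list \<Rightarrow> bool list" where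
  "knownB \<pi> y \<equiv> known (msgB \<pi> y) []"

primrec slots :: "party \<Rightarrow> nat \<Rightarrow> party list" where
  "slots P 0 = []"
| "slots P (Suc N) = P # P # slots (case P of Alice \<Rightarrow> Bob | Bob \<Rightarrow> Alice) N"

lemma length_slots [simp]: "length (slots P N) = 2 * N"
  by (induction N arbitrary: P) auto

text \<open>The decoders truncate because knowledge may grow past the last round:
  \<open>msgA\<close> and \<open>msgB\<close> are total, so the exchange simply continues.\<close>

definition slot_simulation :: "('a, 'b) protocol \<Rightarrow> nat \<Rightarrow> ('a, 'b) simulation" where
  "slot_simulation \<pi> N =
     \<lparr>speakers = slots Alice N,
      encA = \<lambda>x v. slot_bit (knownA \<pi> x v) v,
      encB = \<lambda>y v. slot_bit (knownB \<pi> y v) v,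
      decA = \<lambda>x v. take (rounds \<pi>) (knownA \<pi> x v),
      decB = \<lambda>y v. take (rounds \<pi>) (knownB \<pi> y v)\<rparr>"

lemma sim_cc_slot_simulation [simp]: "sim_cc (slot_simulation \<pi> N) = 2 * N"
  by (simp add: sim_cc_def slot_simulation_def)

lemma length_exchanged [simp]: "length (exchanged \<pi> x y r) = r"
  by (induction r) (auto simp: Let_def)

lemma take_exchanged: "n \<le> r \<Longrightarrow> take n (exchanged \<pi> x y r) = exchanged \<pi> x y n"
proof (induction r)
  case (Suc r)
  then show ?case by (cases "n = Suc r") (auto simp: Let_def)
qed simp

section \<open>The progress chain\<close>

text \<open>The flag says whether the next sender is ahead.\<close>

primrec progress :: "real \<Rightarrow> nat \<Rightarrow> nat \<Rightarrow> bool \<Rightarrow> (nat \<times> bool) pmf" where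
  "progress \<epsilon> 0 k g = return_pmf (k, g)"
| "progress \<epsilon> (Suc N) k g =
     (if g
      then bernoulli_pmf \<epsilon> \<bind> (\<lambda>e. bernoulli_pmf \<epsilon> \<bind> (\<lambda>e'.
             if e \<or> e' then progress \<epsilon> N k False else progress \<epsilon> N (Suc k) True))
      else progress \<epsilon> N k True)"

lemma finite_set_pmf_progress: "finite (set_pmf (progress \<epsilon> N k g))"
  by (induction N arbitrary: k g) auto

section \<open>Reduction of the simulation to the chain\<close>

text \<open>\<open>k\<close> counts the accepted slots. Bob accepts first and acceptances alternate,
  so Alice has accepted \<open>k div 2\<close> of them and Bob \<open>Suc k div 2\<close>, each
  worth two bits. The induction runs over the remaining slots while the simulation is fixed, hence
  \<open>M\<close> besides \<open>N\<close>.\<close>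

lemma map_run_from_slots:
  fixes \<pi> :: "('a, 'b) protocol" and k :: nat
  assumes "even (length vA)" "even (length vB)"
    and "knownA \<pi> x vA = exchanged \<pi> x y (Suc (2 * (k div 2)))"
    and "knownB \<pi> y vB = exchanged \<pi> x y (2 * (Suc k div 2))"
  shows "map_pmf (\<lambda>(vA, vB). (knownA \<pi> x vA, knownB \<pi> y vB))
           (run_from \<epsilon> (slot_simulation \<pi> M) x y (slots P N) vA vB) =
         map_pmf (\<lambda>(k, _). (exchanged \<pi> x y (Suc (2 * (k div 2))), exchanged \<pi> x y (2 * (Suc k div 2))))
           (progress \<epsilon> N k ((P = Alice) = even k))"
  using assms
proof (induction N arbitrary: P k vA vB)
  case 0
  then show ?case by simp
next
  case (Suc N)
  let ?R = "\<lambda>P vA vB. map_pmf (\<lambda>(vA, vB). (knownA \<pi> x vA, knownB \<pi> y vB))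
       (run_from \<epsilon> (slot_simulation \<pi> M) x y (slots P N) vA vB)"
  let ?C = "\<lambda>k g. map_pmf (\<lambda>(k, _). (exchanged \<pi> x y (Suc (2 * (k div 2))),
       exchanged \<pi> x y (2 * (Suc k div 2)))) (progress \<epsilon> N k g)"
  let ?S = "\<lambda>b e. Received (if e then None else Some b)"
  note prems = Suc.prems
  show ?case
  proof (cases P)
    case Alice
    define b where "b = last (knownA \<pi> x vA)"
    define c where "c = even (length (knownA \<pi> x vA) div 2)"
    have step: "?R Bob (vA @ [Sent b, Sent c]) (vB @ [?S b e, ?S c e']) =
        (if \<not> e \<and> \<not> e' \<and> even k then ?C (Suc k) True else ?C k (odd k))" for e e'
    proof (cases "\<not> e \<and> \<not> e' \<and> even k")
      case True
      then obtain j where k: "k = 2 * j" by auto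
      have "knownB \<pi> y (vB @ [?S b e, ?S c e']) = exchanged \<pi> x y (2 * (Suc (Suc k) div 2))"
        using True prems unfolding k
        by (simp add: known_append_slot slot_update_def b_def c_def Let_def)
      with True prems show ?thesis unfolding k
        by (subst Suc.IH[where k = "Suc k"])
           (auto simp: k known_append_slot slot_update_def Let_def)
    next
      case False
      \<comment> \<open>For \<open>k = 2 * j + 1\<close> Alice sends the parity of \<open>j\<close>
        while Bob expects that of \<open>j + 1\<close>, so he rejects her old bit even without
        erasures.\<close>
      have "odd k \<Longrightarrow> c \<noteq> even (Suc (length (knownB \<pi> y vB)) div 2)"
        using prems(3,4) by (auto simp: c_def simp del: exchanged.simps elim!: oddE)
      with False prems show ?thesis
        by (subst Suc.IH[where k = k])
           (auto simp: known_append_slot slot_update_def simp del: exchanged.simps split: if_splits)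
    qed
    \<comment> \<open>For odd \<open>k\<close> the result is the same for all erasures, so both
      Bernoulli draws drop out and leave the deterministic step of \<open>progress\<close>.\<close>
    have "?R Bob (vA @ [Sent b, Sent c]) (vB @ [?S b e, ?S c e']) =
       (if even k then if e \<or> e' then ?C k False else ?C (Suc k) True else ?C k True)" for e e'
      unfolding step by auto
    moreover have "map_pmf (\<lambda>(vA, vB). (knownA \<pi> x vA, knownB \<pi> y vB))
        (run_from \<epsilon> (slot_simulation \<pi> M) x y (slots P (Suc N)) vA vB) =
      bernoulli_pmf \<epsilon> \<bind> (\<lambda>e. bernoulli_pmf \<epsilon> \<bind> (\<lambda>e'.
        ?R Bob (vA @ [Sent b, Sent c]) (vB @ [?S b e, ?S c e'])))"
      using prems(1,2) unfolding b_def c_def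
      by (simp add: Alice bec_def slot_simulation_def slot_bit_def known_snoc
          map_bind_pmf bind_map_pmf Let_def)
    ultimately show ?thesis
      by (cases "even k")
         (simp_all add: Alice map_bind_pmf if_distrib[where f = "map_pmf h" for h]
           del: run_from.simps slots.simps exchanged.simps)
  next
    case Bob
    define b where "b = last (knownB \<pi> y vB)"
    define c where "c = even (length (knownB \<pi> y vB) div 2)"
    have step: "?R Alice (vA @ [?S b e, ?S c e']) (vB @ [Sent b, Sent c]) =
        (if \<not> e \<and> \<not> e' \<and> odd k then ?C (Suc k) True else ?C k (even k))" for e e'
    proof (cases "\<not> e \<and> \<not> e' \<and> odd k")
      case True
      then obtain j where k: "k = Suc (2 * j)" by (auto elim!: oddE)
      have "knownA \<pi> x (vA @ [?S b e, ?S c e']) = exchanged \<pi> x y (Suc (2 * (Suc k div 2)))"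
        using True prems unfolding k
        by (simp add: known_append_slot slot_update_def b_def c_def Let_def)
      with True prems show ?thesis unfolding k
        by (subst Suc.IH[where k = "Suc k"])
           (auto simp: k known_append_slot slot_update_def Let_def)
    next
      case False
      \<comment> \<open>With \<open>k = 2 * j\<close> the half lengths are again \<open>j\<close>
        and \<open>j + 1\<close>. The case \<open>j = 0\<close> is the rejection of Bob's
        unspecified \<open>last []\<close>.\<close>
      have "even k \<Longrightarrow> c \<noteq> even (Suc (length (knownA \<pi> x vA)) div 2)"
        using prems(3,4) by (auto simp: c_def simp del: exchanged.simps elim!: evenE)
      with False prems show ?thesis
        by (subst Suc.IH[where k = k])
           (auto simp: known_append_slot slot_update_def simp del: exchanged.simps split: if_splits)
    qed
    have "?R Alice (vA @ [?S b e, ?S c e']) (vB @ [Sent b, Sent c]) =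
       (if odd k then if e \<or> e' then ?C k False else ?C (Suc k) True else ?C k True)" for e e'
      unfolding step by auto
    moreover have "map_pmf (\<lambda>(vA, vB). (knownA \<pi> x vA, knownB \<pi> y vB))
        (run_from \<epsilon> (slot_simulation \<pi> M) x y (slots P (Suc N)) vA vB) =
      bernoulli_pmf \<epsilon> \<bind> (\<lambda>e. bernoulli_pmf \<epsilon> \<bind> (\<lambda>e'.
        ?R Alice (vA @ [?S b e, ?S c e']) (vB @ [Sent b, Sent c])))"
      using prems(1,2) unfolding b_def c_def
      by (simp add: Bob bec_def slot_simulation_def slot_bit_def known_snoc
          map_bind_pmf bind_map_pmf Let_def)
    ultimately show ?thesis
      by (cases "even k")
         (simp_all add: Bob map_bind_pmf if_distrib[where f = "map_pmf h" for h]
           del: run_from.simps slots.simps exchanged.simps)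
  qed
qed

text \<open>After \<open>k\<close> accepted slots one party knows \<open>k\<close> correct bits and
  the other \<open>k + 1\<close>, so an error forces \<open>k < rounds \<pi>\<close>.\<close>

lemma error_prob_at_slot_simulation:
  "error_prob_at \<epsilon> \<pi> (slot_simulation \<pi> N) x y
     \<le> measure_pmf.prob (progress \<epsilon> N 0 True) {(k, g). k < rounds \<pi>}"
proof -
  let ?n = "rounds \<pi>" and ?\<tau> = "slot_simulation \<pi> N"
  let ?err = "{(mA, mB). take ?n mA \<noteq> transcript \<pi> x y \<or> take ?n mB \<noteq> transcript \<pi> x y}"
  let ?f = "\<lambda>(k, _ :: bool). (exchanged \<pi> x y (Suc (2 * (k div 2))), exchanged \<pi> x y (2 * (Suc k div 2)))"
  have "error_prob_at \<epsilon> \<pi> ?\<tau> x y =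
      measure_pmf.prob (map_pmf (\<lambda>(vA, vB). (knownA \<pi> x vA, knownB \<pi> y vB))
        (run_from \<epsilon> ?\<tau> x y (slots Alice N) [] [])) ?err"
    by (auto simp: error_prob_at_def run_sim_def slot_simulation_def
        intro!: arg_cong2[where f = measure])
  also have "\<dots> = measure_pmf.prob (map_pmf ?f (progress \<epsilon> N 0 True)) ?err"
    by (subst map_run_from_slots[where k = 0]) auto
  also have "\<dots> = measure_pmf.prob (progress \<epsilon> N 0 True) (?f -` ?err)"
    by simp
  finally have eq: "error_prob_at \<epsilon> \<pi> ?\<tau> x y =
      measure_pmf.prob (progress \<epsilon> N 0 True) (?f -` ?err)" .
  have "k < ?n" if "?f (k, g) \<in> ?err" for k g
  proof (rule ccontr)
    assume "\<not> k < ?n"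
    then have "?n \<le> Suc (2 * (k div 2))" "?n \<le> 2 * (Suc k div 2)" by presburger+
    then show False
      using that by (simp add: transcript_def take_exchanged del: exchanged.simps)
  qed
  then have "measure_pmf.prob (progress \<epsilon> N 0 True) (?f -` ?err)
      \<le> measure_pmf.prob (progress \<epsilon> N 0 True) {(k, g). k < ?n}"
    by (intro measure_pmf.finite_measure_mono) auto
  then show ?thesis by (simp only: eq)
qed

section \<open>Second-moment bound for the chain\<close>

lemma expectation_bind_bernoulli:
  fixes h :: "'a \<Rightarrow> real"
  assumes "\<epsilon> \<in> {0..1}" "\<And>b. finite (set_pmf (f b))"
  shows "measure_pmf.expectation (bernoulli_pmf \<epsilon> \<bind> f) h =
    \<epsilon> * measure_pmf.expectation (f True) h + (1 - \<epsilon>) * measure_pmf.expectation (f False) h"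
  using assms by (subst pmf_expectation_bind[where A = UNIV]) (auto simp: UNIV_bool)

text \<open>
  The offset \<open>- r\<close> for a sender who is not ahead pays for the wasted slot and makes
  the potential minus \<open>r\<close> times the number of slots a martingale.
\<close>

definition potential :: "real \<Rightarrow> nat \<times> bool \<Rightarrow> real" where
  "potential r = (\<lambda>(k, g). real k - (if g then 0 else r))"

text \<open>The martingale moves by at most 2 per slot, which adds at most 4 to its mean square
  deviation from \<open>a\<close>. The equation for \<open>r\<close> says
  \<open>p * (1 - r) = (1 - p) * (2 * r)\<close>, that is, zero drift when the sender is
  ahead.\<close>

lemma expectation_progress_square:
  assumes \<epsilon>: "\<epsilon> \<in> {0..1}" and p: "p = (1 - \<epsilon>)\<^sup>2" and r: "r * (2 - p) = p"
  shows "measure_pmf.expectation (progress \<epsilon> N k g) (\<lambda>s. (potential r s - a)\<^sup>2)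
           \<le> (potential r (k, g) + r * real N - a)\<^sup>2 + 4 * real N"
proof (induction N arbitrary: k g)
  case 0
  then show ?case by simp
next
  case (Suc N)
  let ?E = "\<lambda>k g. measure_pmf.expectation (progress \<epsilon> N k g) (\<lambda>s. (potential r s - a)\<^sup>2)"
  have p01: "0 \<le> p" "p \<le> 1"
    using \<epsilon> by (auto simp: p power_le_one)
  have "r = p / (2 - p)" using r p01 by (simp add: field_simps)
  with p01 have r01: "0 \<le> r" "r \<le> 1" by simp_all
  show ?case
  proof (cases g)
    case True
    \<comment> \<open>\<open>X\<close> is the deviation before the slot. A failure shifts it by
      \<open>- 2 * r\<close> (the slot itself and the offset), progress by
      \<open>1 - r\<close>.\<close>
    define X where "X = real k + r * real N + r - a"
    have "measure_pmf.expectation (progress \<epsilon> (Suc N) k g) (\<lambda>s. (potential r s - a)\<^sup>2) =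
        (1 - p) * ?E k False + p * ?E (Suc k) True"
      using True \<epsilon>
      by (simp add: expectation_bind_bernoulli finite_set_pmf_progress p power2_eq_square algebra_simps)
    also have "\<dots> \<le> (1 - p) * ((X - 2 * r)\<^sup>2 + 4 * real N) + p * ((X + (1 - r))\<^sup>2 + 4 * real N)"
      using Suc.IH[of k False] Suc.IH[of "Suc k" True] p01
      by (intro add_mono mult_left_mono) (auto simp: potential_def X_def algebra_simps)
    \<comment> \<open>The term linear in \<open>X\<close> is isolated; its coefficient is the drift,
      which vanishes by the choice of \<open>r\<close>.\<close>
    also have "\<dots> = X\<^sup>2 + 2 * X * (p - r * (2 - p)) + ((1 - p) * (4 * r\<^sup>2) + p * (1 - r)\<^sup>2) + 4 * real N"
      by (simp add: power2_eq_square algebra_simps)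
    also have "\<dots> = X\<^sup>2 + ((1 - p) * (4 * r\<^sup>2) + p * (1 - r)\<^sup>2) + 4 * real N"
      using r by simp
    also have "(1 - p) * (4 * r\<^sup>2) + p * (1 - r)\<^sup>2 \<le> (1 - p) * 4 + p * 4"
    proof (intro add_mono mult_left_mono)
      have "r\<^sup>2 \<le> 1" "(1 - r)\<^sup>2 \<le> 1" using r01 by (auto intro!: power_le_one)
      then show "4 * r\<^sup>2 \<le> 4" "(1 - r)\<^sup>2 \<le> 4" by auto
    qed (use p01 in auto)
    finally show ?thesis
      using True by (simp add: X_def potential_def algebra_simps)
  next
    case False
    then show ?thesis
      using Suc.IH[of k True] by (simp add: potential_def algebra_simps)
  qed
qed

text \<open>Chebyshev's inequality: the potential is at most \<open>k\<close> since \<open>r\<close>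
  is nonnegative, so \<open>k < n\<close> puts it more than \<open>r * real N - real n\<close> below
  \<open>r * real N\<close>.\<close>

lemma prob_progress_less:
  assumes \<epsilon>: "\<epsilon> \<in> {0..1}" and p: "p = (1 - \<epsilon>)\<^sup>2" and r: "r * (2 - p) = p"
    and n: "real n < r * real N"
  shows "measure_pmf.prob (progress \<epsilon> N 0 True) {(k, g). k < n} \<le> 4 * real N / (r * real N - real n)\<^sup>2"
proof -
  let ?M = "progress \<epsilon> N 0 True"
  define d where "d = r * real N - real n"
  have d: "d > 0" using n by (simp add: d_def)
  have "p \<le> 1" "0 \<le> p" using \<epsilon> by (auto simp: p power_le_one)
  moreover from this have "r = p / (2 - p)" using r by (simp add: field_simps)
  ultimately have r0: "0 \<le> r" by simp
  have "measure_pmf.prob ?M {(k, g). k < n}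
      \<le> measure_pmf.prob ?M {s. (potential r s - r * real N)\<^sup>2 \<ge> d\<^sup>2}"
  proof (intro measure_pmf.finite_measure_mono subsetI; clarify?)
    fix k g assume "k < n"
    then have "d \<le> r * real N - potential r (k, g)"
      using r0 by (auto simp: potential_def d_def)
    then have "d\<^sup>2 \<le> (r * real N - potential r (k, g))\<^sup>2"
      using d by (intro power_mono) auto
    then show "(potential r (k, g) - r * real N)\<^sup>2 \<ge> d\<^sup>2"
      by (simp add: power2_commute)
  qed auto
  also have "\<dots> \<le> measure_pmf.expectation ?M (\<lambda>s. (potential r s - r * real N)\<^sup>2) / d\<^sup>2"
    using integral_Markov_inequality_measure[where M = "measure_pmf ?M" and A = "{}" and c = "d\<^sup>2"
        and u = "\<lambda>s. (potential r s - r * real N)\<^sup>2"] d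
    by (simp add: integrable_measure_pmf_finite finite_set_pmf_progress)
  \<comment> \<open>The initial potential is 0, so centring at \<open>r * real N\<close> cancels the
    leading square.\<close>
  also have "\<dots> \<le> 4 * real N / d\<^sup>2"
    using expectation_progress_square[OF \<epsilon> p r, of N 0 True "r * real N"]
    by (intro divide_right_mono) (auto simp: potential_def)
  finally show ?thesis by (simp add: d_def)
qed

section \<open>Achievable rates\<close>

lemma error_prob_le:
  assumes "\<And>x y. error_prob_at \<epsilon> \<pi> \<tau> x y \<le> c"
  shows "error_prob \<epsilon> \<pi> \<tau> \<le> c"
  unfolding error_prob_def using assms by (intro cSUP_least) auto

lemma error_prob_nonneg: "0 \<le> error_prob \<epsilon> \<pi> \<tau>"
proof -
  \<comment> \<open>Input types are nonempty, so any one pair of inputs bounds the supremum from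
    below.\<close>
  have "0 \<le> error_prob_at \<epsilon> \<pi> \<tau> undefined undefined"
    by (simp add: error_prob_at_def)
  also have "\<dots> = (case (undefined, undefined) of (x, y) \<Rightarrow> error_prob_at \<epsilon> \<pi> \<tau> x y)"
    by simp
  also have "\<dots> \<le> error_prob \<epsilon> \<pi> \<tau>"
    unfolding error_prob_def
    by (intro cSUP_upper bdd_aboveI[where M = 1]) (auto simp: error_prob_at_def)
  finally show ?thesis .
qed

text \<open>About \<open>n / (2 * R)\<close> slots cost \<open>n / R\<close> channel uses. The mean
  progress then exceeds \<open>n\<close> by about \<open>\<delta> * n\<close>, with mean square
  deviation linear in \<open>n\<close>, so the error is \<open>O(1/n)\<close>.\<close>

lemma achievable_rate_slots:
  assumes \<epsilon>: "\<epsilon> \<in> {0..1}" and p: "p = (1 - \<epsilon>)\<^sup>2" and r: "r * (2 - p) = p"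
    and R: "0 < R" "2 * R < r"
  shows "achievable_rate TYPE('a) TYPE('b) \<epsilon> R"
  unfolding achievable_rate_def
proof (intro conjI allI impI)
  fix \<pi> :: "nat \<Rightarrow> ('a, 'b) protocol"
  assume rounds: "\<forall>n\<ge>1. rounds (\<pi> n) = n"
  define N where "N n = nat \<lceil>real n / (2 * R)\<rceil>" for n
  define \<delta> where "\<delta> = r / (2 * R) - 1"
  have \<delta>: "\<delta> > 0" using R by (simp add: \<delta>_def)
  have N_ge: "real n / (2 * R) \<le> real (N n)" for n
    unfolding N_def by linarith
  have N_le: "real (N n) \<le> real n / (2 * R) + 1" for n
    using R unfolding N_def by (simp add: of_nat_nat ceiling_correct)
  have rate: "(\<lambda>n. real n / real (sim_cc (slot_simulation (\<pi> n) (N n)))) \<longlonglongrightarrow> R"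
  proof (rule tendsto_sandwich)
    show "\<forall>\<^sub>F n in sequentially. real n / (real n / R + 2)
        \<le> real n / real (sim_cc (slot_simulation (\<pi> n) (N n)))"
      using eventually_gt_at_top[of 0]
    proof eventually_elim
      case (elim n)
      then have "0 < real (N n)" using N_ge[of n] R by (smt (verit) divide_pos_pos of_nat_0_less_iff)
      moreover from this have "0 < real n / R + 2" using R by (intro add_nonneg_pos) auto
      moreover have "2 * real (N n) \<le> real n / R + 2" using N_le[of n] by simp
      ultimately show ?case by (intro divide_left_mono) auto
    qed
    show "\<forall>\<^sub>F n in sequentially. real n / real (sim_cc (slot_simulation (\<pi> n) (N n))) \<le> R"
    proof (rule always_eventually, rule allI)
      fix n
      show "real n / real (sim_cc (slot_simulation (\<pi> n) (N n))) \<le> R"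
        \<comment> \<open>\<open>N n = 0\<close> happens only for \<open>n = 0\<close>, where the
          quotient is 0 by the division convention.\<close>
        using N_ge[of n] R by (cases "N n = 0") (auto simp: field_simps)
    qed
    show "(\<lambda>n. real n / (real n / R + 2)) \<longlonglongrightarrow> R" using R by real_asymp
  qed simp
  have err: "(\<lambda>n. error_prob \<epsilon> (\<pi> n) (slot_simulation (\<pi> n) (N n))) \<longlonglongrightarrow> 0"
  proof (rule tendsto_sandwich)
    show "\<forall>\<^sub>F n in sequentially. 0 \<le> error_prob \<epsilon> (\<pi> n) (slot_simulation (\<pi> n) (N n))"
      by (simp add: error_prob_nonneg)
    show "\<forall>\<^sub>F n in sequentially. error_prob \<epsilon> (\<pi> n) (slot_simulation (\<pi> n) (N n))
        \<le> 4 * (real n / (2 * R) + 1) / (\<delta> * real n)\<^sup>2"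
      using eventually_gt_at_top[of 0]
    proof eventually_elim
      case (elim n)
      have "r * (real n / (2 * R)) \<le> r * real (N n)"
        using N_ge[of n] R by (intro mult_left_mono) auto
      then have gap: "\<delta> * real n \<le> r * real (N n) - real n"
        by (simp add: \<delta>_def algebra_simps)
      have pos: "0 < \<delta> * real n" using elim \<delta> by simp
      have "error_prob \<epsilon> (\<pi> n) (slot_simulation (\<pi> n) (N n))
          \<le> 4 * real (N n) / (r * real (N n) - real n)\<^sup>2"
      proof (rule error_prob_le)
        fix x y
        show "error_prob_at \<epsilon> (\<pi> n) (slot_simulation (\<pi> n) (N n)) x y
            \<le> 4 * real (N n) / (r * real (N n) - real n)\<^sup>2"
          using error_prob_at_slot_simulation[of \<epsilon> "\<pi> n" "N n" x y]
            prob_progress_less[OF \<epsilon> p r, of n "N n"] rounds elim gap pos by simp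
      qed
      also have "\<dots> \<le> 4 * (real n / (2 * R) + 1) / (\<delta> * real n)\<^sup>2"
        using N_le[of n] gap pos elim \<delta> R by (intro frac_le power_mono) auto
      finally show ?case .
    qed
    show "(\<lambda>n. 4 * (real n / (2 * R) + 1) / (\<delta> * real n)\<^sup>2) \<longlonglongrightarrow> 0"
      using R \<delta> by real_asymp
  qed simp
  show "\<exists>\<tau> :: nat \<Rightarrow> ('a, 'b) simulation.
      (\<lambda>n. real n / real (sim_cc (\<tau> n))) \<longlonglongrightarrow> R \<and> (\<lambda>n. error_prob \<epsilon> (\<pi> n) (\<tau> n)) \<longlonglongrightarrow> 0"
    using rate err by (intro exI[where x = "\<lambda>n. slot_simulation (\<pi> n) (N n)"] conjI)
qed (use R in simp)

theorem theorem2: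
  fixes \<epsilon> :: real
  assumes "\<epsilon> \<in> {0<..<1}"
  shows "interactive_capacity TYPE('a) TYPE('b) \<epsilon>
           \<ge> ereal ((1 - \<epsilon>)\<^sup>2 / (2 * (2 - (1 - \<epsilon>)\<^sup>2)))"
proof -
  define p where "p = (1 - \<epsilon>)\<^sup>2"
  define r where "r = p / (2 - p)"
  have p01: "0 < p" "p \<le> 1" using assms by (auto simp: p_def power_le_one)
  have r: "r * (2 - p) = p" "0 < r" using p01 by (auto simp: r_def)
  have "ereal (r / 2) \<le> interactive_capacity TYPE('a) TYPE('b) \<epsilon>"
    unfolding le_Sup_iff interactive_capacity_def
  proof (intro allI impI)
    fix z :: ereal
    assume "z < ereal (r / 2)"
    \<comment> \<open>Achievability is available for positive rates strictly below
      \<open>r / 2\<close>, so a possibly negative \<open>z\<close> is first raised to 0.\<close>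
    then have "max z 0 < ereal (r / 2)" using r by simp
    then obtain R where "max z 0 < ereal R" "ereal R < ereal (r / 2)"
      using ereal_dense2 by blast
    moreover from this have "achievable_rate TYPE('a) TYPE('b) \<epsilon> R"
      using assms r by (intro achievable_rate_slots[OF _ p_def r(1)]) auto
    ultimately show "\<exists>s\<in>ereal ` {R. achievable_rate TYPE('a) TYPE('b) \<epsilon> R}. z < s"
      by auto
  qed
  then show ?thesis by (simp add: r_def p_def mult.commute)
qed

end
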